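(* Let $\gamma_{\mathrm{pic}}=h/(2\bar\mu)$ and let $\gamma_0,\gamma_r\in(0,\infty]$ be thresholds such that $(\mathcal I-\gamma A_2)^{-1}>0$ entrywise for all finite $\gamma\ge\gamma_0$ and $r_{02}(\gamma A_2)=(\mathcal I-\gamma A_2+\tfrac{\gamma^2}{2}A_2^2)^{-1}>0$ entrywise for all finite $\gamma\ge\gamma_r$. (a) (Positivity and conservation) If $\gamma_{\mathrm{pic}}\ge\min(\gamma_0,\gamma_r)$, then for every $\gamma>0$ the directional step $(\mathcal I-\gamma A_2)\bm p=\bm b$ admits a realization that is entrywise nonnegative on nonnegative data $\bm b$, exactly mass-conservative ($\mathbf 1^\top\bm p=\mathbf 1^\top\bm b$), and second-order consistent in space wherever the density is resolved: scheme FCDF-B for $\gamma\le\gamma_{\mathrm{pic}}$, and whichever of the linear maps $(\mathcal I-\gamma A_2)^{-1}$, $r_{02}(\gamma A_2)$ is positive for $\gamma\ge\min(\gamma_0,\gamma_r)$, with a switchover anywhere in the overlap. (b) (Full second order) If, in addition, $\gamma_{\mathrm{pic}}\ge\gamma_r$, then the realization can be chosen second-order in time as well: scheme FCDF-DC for $\gamma\le\gamma_{\mathrm{pic}}$ and the Padé$(0,2)$ map $r_{02}(\gamma A_2)$ for $\gamma\ge\gamma_r$, so the time stepping is positive, conservative, and second-order in time and space, wherever the density is resolved, for every step size. Moreover $\gamma_{\mathrm{pic}}\ge\gamma_r$ implies $\gamma_{\mathrm{pic}}\ge\min(\gamma_0,\gamma_r)$.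
   Context: Grid and operators. Uniform grid $x_i=x_1+(i-1)h$, $i=1,\dots,n$, nodal drift values $\mu_i>0$, diffusion values $D_i\ge0$, $\bar\mu=\max_i|\mu_i|$. Interfaces $i+1/2$, $i=0,\dots,n$; boundary interfaces carry no flux. For $\bm p\in\mathbb R^n$: $(A_1\bm p)_i=-[\hat J^{(1)}_{i+1/2}-\hat J^{(1)}_{i-1/2}]/h$ with $\hat J^{(1)}_{i+1/2}(\bm p)=\mu_ip_i-(D_{i+1}p_{i+1}-D_ip_i)/h$ for $1\le i\le n-1$ and zero at boundary interfaces; $d_{i+1/2}(\bm p)=\tfrac12(\mu_ip_i-\mu_{i-1}p_{i-1})$ for $2\le i\le n-1$ and $d_{1/2}=d_{3/2}=d_{n+1/2}=0$; $(C\bm p)_i=-[d_{i+1/2}(\bm p)-d_{i-1/2}(\bm p)]/h$; $A_2=A_1+C$. $A_1$ and $A_2$ are irreducible and $\mathbf 1^\top A_1=\mathbf 1^\top A_2=0$. The total numerical flux is $\hat J_{i+1/2}(\bm w)=\hat J^{(1)}_{i+1/2}(\bm w)+d_{i+1/2}(\bm w)$, so $(A_2\bm w)_i=-[\hat J_{i+1/2}(\bm w)-\hat J_{i-1/2}(\bm w)]/h$. FCDF-B. For $\bm b\ge0$ and step $\gamma$: a solution $\bm p$ of $(\mathcal I-\gamma A_1)\bm p=\bm b+\gamma D_\Lambda(\bm p)$, where $(D_\Lambda(\bm p))_i=-[\Lambda_{i+1/2}(\bm p)-\Lambda_{i-1/2}(\bm p)]/h$ and $\Lambda_{i+1/2}(\bm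 p)=\max(-\tfrac{hb_{i+1}}{2\gamma},\min(d_{i+1/2}(\bm p),\tfrac{hb_i}{2\gamma}))$ at interior interfaces, zero at boundary interfaces. FCDF-DC. With $\gamma=\Delta t$ and data $\bm p^n\ge0$: two limited stages. With given fixed fluxes $G_{i+1/2}$ (zero at boundary interfaces), a limited stage solution is a solution $\bm p$ of $\bigl((\mathcal I-\Delta t A_1)\bm p\bigr)_i=p^n_i-[\widetilde\Lambda_{i+1/2}(\bm p)-\widetilde\Lambda_{i-1/2}(\bm p)]/h$ with $\widetilde\Lambda_{i+1/2}(\bm p)=\max(-\tfrac{hp^n_{i+1}}2,\min(\Delta t\,d_{i+1/2}(\bm p)+G_{i+1/2},\tfrac{hp^n_i}2))$ at interior interfaces, zero at boundary interfaces. The predictor $\bm Y_0$ uses $G\equiv0$; the corrector $\bm p^{n+1}$ uses $G_{i+1/2}=-\tfrac{\Delta t^2}{2}\hat J_{i+1/2}(A_2\bm Y_0)$. Without clamping, the two stages are $(\mathcal I-\Delta tA_2)\bm Y_0=\bm p^n$, $(\mathcal I-\Delta tA_2)\bm p^{n+1}=\bm p^n-\tfrac{\Delta t^2}2A_2^2\bm Y_0$, with stability function $R(z)=(1-z-z^2/2)/(1-z)^2$. Meaning of "wherever the density is resolved". For the limited schemes: on rows whose two adjacent interface clamps are inactive (the clamp acts as the identity) at the fixed point(s) of all stages. "Second-order consistent in space" there means that the row of the computed system coincides with the corresponding row of the unlimited scheme built on the second-order operator $A_2$; the linear maps use $A_2$ at all rows. "Second-order in time" means that the (unlimited) stability function ($R(z)$,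 respectively $r_{02}(z)=1/(1-z+z^2/2)$) agrees with $e^z$ up to $O(z^3)$ as $z\to0$. *)

theory Defs
  imports
    "HOL-Analysis.Analysis"
    "HOL-Library.Landau_Symbols"
    "Jordan_Normal_Form.Gauss_Jordan_Elimination"
begin

(* Only the values of drift and diffusion at the nodes 1, ..., npts matter. *)
record fp_grid =
  npts :: nat
  mesh :: real
  drift :: "nat \<Rightarrow> real"
  diffusion :: "nat \<Rightarrow> real"

definition valid_grid :: "fp_grid \<Rightarrow> bool" where
  "valid_grid g \<longleftrightarrow> 1 \<le> npts g \<and> 0 < mesh g \<and>
     (\<forall>i\<in>{1..npts g}. 0 < drift g i \<and> 0 \<le> diffusion g i)"

definition mubar :: "fp_grid \<Rightarrow> real" where
  "mubar g = Max ((\<lambda>i. \<bar>drift g i\<bar>) ` {1..npts g})"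

definition gamma_pic :: "fp_grid \<Rightarrow> real" where
  "gamma_pic g = mesh g / (2 * mubar g)"

(* Nodes are numbered from 1 but vector entries from 0: row k of a vector belongs to node k + 1. *)
definition nd :: "real vec \<Rightarrow> nat \<Rightarrow> real" where
  "nd p i = p $ (i - 1)"

(* The interface i + 1/2 (i = 0, ..., npts) is represented by the index i, so the interfaces
   adjacent to row k are k (left) and k + 1 (right). *)
definition interior :: "fp_grid \<Rightarrow> nat \<Rightarrow> bool" where
  "interior g i \<longleftrightarrow> 1 \<le> i \<and> i < npts g"

definition minus_div :: "fp_grid \<Rightarrow> (nat \<Rightarrow> real) \<Rightarrow> real vec" where
  "minus_div g F = vec (npts g) (\<lambda>k. - (F (k + 1) - F k) / mesh g)"

definition J1 :: "fp_grid \<Rightarrow> real vec \<Rightarrow> nat \<Rightarrow> real" where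
  "J1 g p i = (if interior g i
     then drift g i * nd p i
          - (diffusion g (i + 1) * nd p (i + 1) - diffusion g i * nd p i) / mesh g
     else 0)"

definition dflux :: "fp_grid \<Rightarrow> real vec \<Rightarrow> nat \<Rightarrow> real" where
  "dflux g p i = (if 2 \<le> i \<and> i < npts g
     then 1/2 * (drift g i * nd p i - drift g (i - 1) * nd p (i - 1)) else 0)"

definition Jtot :: "fp_grid \<Rightarrow> real vec \<Rightarrow> nat \<Rightarrow> real" where
  "Jtot g p i = J1 g p i + dflux g p i"

definition matrix_of :: "nat \<Rightarrow> (real vec \<Rightarrow> real vec) \<Rightarrow> real mat" where
  "matrix_of n T = mat n n (\<lambda>(i, j). T (unit_vec n j) $ i)"

definition A1 :: "fp_grid \<Rightarrow> real mat" where
  "A1 g = matrix_of (npts g) (\<lambda>p. minus_div g (J1 g p))"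

definition C :: "fp_grid \<Rightarrow> real mat" where
  "C g = matrix_of (npts g) (\<lambda>p. minus_div g (dflux g p))"

definition A2 :: "fp_grid \<Rightarrow> real mat" where
  "A2 g = A1 g + C g"

definition irreducible_mat :: "real mat \<Rightarrow> bool" where
  "irreducible_mat A \<longleftrightarrow> (\<forall>i<dim_row A. \<forall>j<dim_row A.
     (i, j) \<in> {(k, l). k < dim_row A \<and> l < dim_row A \<and> A $$ (k, l) \<noteq> 0}\<^sup>*)"

definition nonneg_vec :: "real vec \<Rightarrow> bool" where
  "nonneg_vec p \<longleftrightarrow> (\<forall>i<dim_vec p. 0 \<le> p $ i)"

definition mass :: "real vec \<Rightarrow> real" where
  "mass p = (\<Sum>i<dim_vec p. p $ i)"

definition clamp_to :: "real \<Rightarrow> real \<Rightarrow> real \<Rightarrow> real" where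
  "clamp_to lo hi x = max lo (min x hi)"

definition euler1_mat :: "fp_grid \<Rightarrow> real \<Rightarrow> real mat" where
  "euler1_mat g \<gamma> = 1\<^sub>m (npts g) - \<gamma> \<cdot>\<^sub>m A1 g"

definition euler2_mat :: "fp_grid \<Rightarrow> real \<Rightarrow> real mat" where
  "euler2_mat g \<gamma> = 1\<^sub>m (npts g) - \<gamma> \<cdot>\<^sub>m A2 g"

definition pade02_mat :: "fp_grid \<Rightarrow> real \<Rightarrow> real mat" where
  "pade02_mat g \<gamma> = 1\<^sub>m (npts g) - \<gamma> \<cdot>\<^sub>m A2 g + (\<gamma>\<^sup>2 / 2) \<cdot>\<^sub>m (A2 g * A2 g)"

definition pos_inverse :: "real mat \<Rightarrow> bool" where
  "pos_inverse M \<longleftrightarrow> (\<exists>B. mat_inverse M = Some B \<and>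
     (\<forall>i<dim_row M. \<forall>j<dim_col M. 0 < B $$ (i, j)))"

definition apply_inverse :: "real mat \<Rightarrow> real vec \<Rightarrow> real vec \<Rightarrow> bool" where
  "apply_inverse M b p \<longleftrightarrow> (\<exists>B. mat_inverse M = Some B \<and> p = B *\<^sub>v b)"

text \<open>Scheme FCDF-B.\<close>

definition lamB :: "fp_grid \<Rightarrow> real \<Rightarrow> real vec \<Rightarrow> real vec \<Rightarrow> nat \<Rightarrow> real" where
  "lamB g \<gamma> b p i = (if interior g i
     then clamp_to (- (mesh g * nd b (i + 1) / (2 * \<gamma>))) (mesh g * nd b i / (2 * \<gamma>)) (dflux g p i)
     else 0)"

definition fcdfB_residual :: "fp_grid \<Rightarrow> real \<Rightarrow> real vec \<Rightarrow> real vec \<Rightarrow> real vec" where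
  "fcdfB_residual g \<gamma> b p =
     euler1_mat g \<gamma> *\<^sub>v p - (b + \<gamma> \<cdot>\<^sub>v minus_div g (lamB g \<gamma> b p))"

definition fcdfB :: "fp_grid \<Rightarrow> real \<Rightarrow> real vec \<Rightarrow> real vec \<Rightarrow> bool" where
  "fcdfB g \<gamma> b p \<longleftrightarrow> p \<in> carrier_vec (npts g) \<and> fcdfB_residual g \<gamma> b p = 0\<^sub>v (npts g)"

text \<open>Scheme FCDF-DC.\<close>

definition lamDC ::
  "fp_grid \<Rightarrow> real \<Rightarrow> real vec \<Rightarrow> (nat \<Rightarrow> real) \<Rightarrow> real vec \<Rightarrow> nat \<Rightarrow> real" where
  "lamDC g dt pn G p i = (if interior g i
     then clamp_to (- (mesh g * nd pn (i + 1) / 2)) (mesh g * nd pn i / 2) (dt * dflux g p i + G i)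
     else 0)"

definition stage_residual ::
  "fp_grid \<Rightarrow> real \<Rightarrow> real vec \<Rightarrow> (nat \<Rightarrow> real) \<Rightarrow> real vec \<Rightarrow> real vec" where
  "stage_residual g dt pn G p =
     euler1_mat g dt *\<^sub>v p - (pn + minus_div g (lamDC g dt pn G p))"

definition limited_stage ::
  "fp_grid \<Rightarrow> real \<Rightarrow> real vec \<Rightarrow> (nat \<Rightarrow> real) \<Rightarrow> real vec \<Rightarrow> bool" where
  "limited_stage g dt pn G p \<longleftrightarrow>
     p \<in> carrier_vec (npts g) \<and> stage_residual g dt pn G p = 0\<^sub>v (npts g)"

definition Gcorr :: "fp_grid \<Rightarrow> real \<Rightarrow> real vec \<Rightarrow> nat \<Rightarrow> real" where
  "Gcorr g dt Y0 i = - (dt\<^sup>2 / 2) * Jtot g (A2 g *\<^sub>v Y0) i"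

definition fcdfDC :: "fp_grid \<Rightarrow> real \<Rightarrow> real vec \<Rightarrow> real vec \<Rightarrow> real vec \<Rightarrow> bool" where
  "fcdfDC g dt pn Y0 p \<longleftrightarrow>
     limited_stage g dt pn (\<lambda>i. 0) Y0 \<and> limited_stage g dt pn (Gcorr g dt Y0) p"

text \<open>Row residuals of the unlimited schemes built on the second-order operator.\<close>

definition euler2_residual :: "fp_grid \<Rightarrow> real \<Rightarrow> real vec \<Rightarrow> real vec \<Rightarrow> real vec" where
  "euler2_residual g \<gamma> b p = euler2_mat g \<gamma> *\<^sub>v p - b"

definition corr2_residual ::
  "fp_grid \<Rightarrow> real \<Rightarrow> real vec \<Rightarrow> real vec \<Rightarrow> real vec \<Rightarrow> real vec" where
  "corr2_residual g dt pn Y0 p =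
     euler2_mat g dt *\<^sub>v p - (pn - (dt\<^sup>2 / 2) \<cdot>\<^sub>v (A2 g *\<^sub>v (A2 g *\<^sub>v Y0)))"

definition pade02_residual :: "fp_grid \<Rightarrow> real \<Rightarrow> real vec \<Rightarrow> real vec \<Rightarrow> real vec" where
  "pade02_residual g \<gamma> b p = pade02_mat g \<gamma> *\<^sub>v p - b"

text \<open>A row is resolved when the clamps at both adjacent interfaces act as the identity; at
  boundary interfaces both sides vanish.\<close>

definition resolvedB :: "fp_grid \<Rightarrow> real \<Rightarrow> real vec \<Rightarrow> real vec \<Rightarrow> nat \<Rightarrow> bool" where
  "resolvedB g \<gamma> b p k \<longleftrightarrow> (\<forall>i\<in>{k, k + 1}. lamB g \<gamma> b p i = dflux g p i)"

definition resolved_stage ::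
  "fp_grid \<Rightarrow> real \<Rightarrow> real vec \<Rightarrow> (nat \<Rightarrow> real) \<Rightarrow> real vec \<Rightarrow> nat \<Rightarrow> bool" where
  "resolved_stage g dt pn G p k \<longleftrightarrow>
     (\<forall>i\<in>{k, k + 1}. lamDC g dt pn G p i = dt * dflux g p i + G i)"

definition resolvedDC ::
  "fp_grid \<Rightarrow> real \<Rightarrow> real vec \<Rightarrow> real vec \<Rightarrow> real vec \<Rightarrow> nat \<Rightarrow> bool" where
  "resolvedDC g dt pn Y0 p k \<longleftrightarrow>
     resolved_stage g dt pn (\<lambda>i. 0) Y0 k \<and> resolved_stage g dt pn (Gcorr g dt Y0) p k"

datatype scheme = FCDF_B | FCDF_DC | Lin_Euler | Lin_Pade02

fun step :: "fp_grid \<Rightarrow> scheme \<Rightarrow> real \<Rightarrow> real vec \<Rightarrow> real vec \<Rightarrow> bool" where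
  "step g FCDF_B \<gamma> b p = fcdfB g \<gamma> b p"
| "step g FCDF_DC \<gamma> b p = (\<exists>Y0. fcdfDC g \<gamma> b Y0 p)"
| "step g Lin_Euler \<gamma> b p = apply_inverse (euler2_mat g \<gamma>) b p"
| "step g Lin_Pade02 \<gamma> b p = apply_inverse (pade02_mat g \<gamma>) b p"

text \<open>The row of the computed system coincides with the row of the unlimited scheme, whose
  equation therefore holds there.\<close>

definition same_row :: "real vec \<Rightarrow> real vec \<Rightarrow> nat \<Rightarrow> bool" where
  "same_row r r' k \<longleftrightarrow> r $ k = r' $ k \<and> r' $ k = 0"

definition nonneg_data :: "fp_grid \<Rightarrow> real vec set" where
  "nonneg_data g = {b \<in> carrier_vec (npts g). nonneg_vec b}"

fun second_order_space :: "fp_grid \<Rightarrow> scheme \<Rightarrow> real \<Rightarrow> bool" where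
  "second_order_space g FCDF_B \<gamma> =
     (\<forall>b\<in>nonneg_data g. \<forall>p. fcdfB g \<gamma> b p \<longrightarrow>
        (\<forall>k<npts g. resolvedB g \<gamma> b p k \<longrightarrow>
           same_row (fcdfB_residual g \<gamma> b p) (euler2_residual g \<gamma> b p) k))"
| "second_order_space g FCDF_DC \<gamma> =
     (\<forall>b\<in>nonneg_data g. \<forall>Y0 p. fcdfDC g \<gamma> b Y0 p \<longrightarrow>
        (\<forall>k<npts g. resolvedDC g \<gamma> b Y0 p k \<longrightarrow>
           same_row (stage_residual g \<gamma> b (\<lambda>i. 0) Y0) (euler2_residual g \<gamma> b Y0) k \<and>
           same_row (stage_residual g \<gamma> b (Gcorr g \<gamma> Y0) p) (corr2_residual g \<gamma> b Y0 p) k))"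
| "second_order_space g Lin_Euler \<gamma> =
     (\<forall>b\<in>nonneg_data g. \<forall>p. step g Lin_Euler \<gamma> b p \<longrightarrow>
        (\<forall>k<npts g. euler2_residual g \<gamma> b p $ k = 0))"
| "second_order_space g Lin_Pade02 \<gamma> =
     (\<forall>b\<in>nonneg_data g. \<forall>p. step g Lin_Pade02 \<gamma> b p \<longrightarrow>
        (\<forall>k<npts g. pade02_residual g \<gamma> b p $ k = 0))"

text \<open>The nonlinear schemes are defined through solutions of a system, so a realization has to be
  solvable, and the properties are required of every solution.\<close>

definition realization :: "fp_grid \<Rightarrow> scheme \<Rightarrow> real \<Rightarrow> bool" where
  "realization g S \<gamma> \<longleftrightarrow>
     (\<forall>b\<in>nonneg_data g. \<exists>p. step g S \<gamma> b p) \<and>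
     (\<forall>b\<in>nonneg_data g. \<forall>p. step g S \<gamma> b p \<longrightarrow>
        p \<in> carrier_vec (npts g) \<and> nonneg_vec p \<and> mass p = mass b) \<and>
     second_order_space g S \<gamma>"

fun positive_map :: "fp_grid \<Rightarrow> scheme \<Rightarrow> real \<Rightarrow> bool" where
  "positive_map g Lin_Euler \<gamma> = pos_inverse (euler2_mat g \<gamma>)"
| "positive_map g Lin_Pade02 \<gamma> = pos_inverse (pade02_mat g \<gamma>)"
| "positive_map g _ \<gamma> = False"

fun stability :: "scheme \<Rightarrow> complex \<Rightarrow> complex" where
  "stability FCDF_B z = 1 / (1 - z)"
| "stability FCDF_DC z = (1 - z - z\<^sup>2 / 2) / (1 - z)\<^sup>2"
| "stability Lin_Euler z = 1 / (1 - z)"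
| "stability Lin_Pade02 z = 1 / (1 - z + z\<^sup>2 / 2)"

definition second_order_time :: "scheme \<Rightarrow> bool" where
  "second_order_time S \<longleftrightarrow> (\<lambda>z. stability S z - exp z) \<in> O[at 0](\<lambda>z. z ^ 3)"

lemma stability_FCDF_DC:
  assumes "z \<noteq> 1" "(1 - z) * y = q" "(1 - z) * p = q - z\<^sup>2 / 2 * y"
  shows "p = stability FCDF_DC z * q"
proof -
  have nz: "1 - z \<noteq> 0" using assms(1) by simp
  have "(1 - z)\<^sup>2 * p = (1 - z) * ((1 - z) * p)" by (simp add: power2_eq_square)
  also have "\<dots> = (1 - z) * q - z\<^sup>2 / 2 * ((1 - z) * y)"
    unfolding assms(3) by (simp add: algebra_simps)
  also have "\<dots> = (1 - z - z\<^sup>2 / 2) * q"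
    unfolding assms(2) by (simp add: algebra_simps)
  finally show ?thesis using nz by (simp add: field_simps)
qed

lemma matrix_of_minus_div:
  assumes p: "p \<in> carrier_vec (npts g)"
    and lin: "\<And>i. i \<le> npts g \<Longrightarrow>
      F p i = (\<Sum>j<npts g. F (unit_vec (npts g) j) i * p $ j)"
  shows "matrix_of (npts g) (\<lambda>p. minus_div g (F p)) *\<^sub>v p = minus_div g (F p)"
proof (rule eq_vecI)
  fix k assume "k < dim_vec (minus_div g (F p))"
  then have k: "k < npts g" by (simp add: minus_div_def)
  have "minus_div g (F p) $ k
     = - ((\<Sum>j<npts g. F (unit_vec (npts g) j) (k + 1) * p $ j)
          - (\<Sum>j<npts g. F (unit_vec (npts g) j) k * p $ j)) / mesh g"
    using k lin[of k] lin[of "k + 1"] by (simp add: minus_div_def)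
  also have "\<dots> = (\<Sum>j<npts g.
      (- (F (unit_vec (npts g) j) (k + 1) - F (unit_vec (npts g) j) k) / mesh g) * p $ j)"
    by (simp add: sum_subtractf[symmetric] sum_negf[symmetric] sum_divide_distrib
        left_diff_distrib diff_divide_distrib)
  also have "\<dots> = (matrix_of (npts g) (\<lambda>p. minus_div g (F p)) *\<^sub>v p) $ k"
    using k p by (simp add: matrix_of_def scalar_prod_def minus_div_def lessThan_atLeast0)
  finally show "(matrix_of (npts g) (\<lambda>p. minus_div g (F p)) *\<^sub>v p) $ k = minus_div g (F p) $ k"
    by simp
qed (simp add: matrix_of_def minus_div_def)

lemma nd_expand:
  assumes "1 \<le> i" "i \<le> n"
  shows "nd p i = (\<Sum>j<n. nd (unit_vec n j) i * p $ j)"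
proof -
  have "(\<Sum>j<n. nd (unit_vec n j) i * p $ j) = (\<Sum>j<n. if j = i - 1 then p $ j else 0)"
    using assms by (intro sum.cong) (auto simp: nd_def)
  then show ?thesis using assms by (simp add: nd_def)
qed

lemma A1_apply:
  assumes "p \<in> carrier_vec (npts g)"
  shows "A1 g *\<^sub>v p = minus_div g (J1 g p)"
  unfolding A1_def
proof (rule matrix_of_minus_div[OF assms])
  fix i assume "i \<le> npts g"
  show "J1 g p i = (\<Sum>j<npts g. J1 g (unit_vec (npts g) j) i * p $ j)"
  proof (cases "interior g i")
    case True
    then have "1 \<le> i" "i + 1 \<le> npts g" by (auto simp: interior_def)
    then have e: "nd p i = (\<Sum>j<npts g. nd (unit_vec (npts g) j) i * p $ j)"
      "nd p (i + 1) = (\<Sum>j<npts g. nd (unit_vec (npts g) j) (i + 1) * p $ j)"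
      using nd_expand[of i "npts g" p] nd_expand[of "i + 1" "npts g" p] by auto
    show ?thesis using True unfolding J1_def e
      by (simp add: sum_subtractf sum_distrib_left sum_divide_distrib left_diff_distrib
          diff_divide_distrib mult.assoc)
  qed (simp add: J1_def)
qed

lemma C_apply:
  assumes "p \<in> carrier_vec (npts g)"
  shows "C g *\<^sub>v p = minus_div g (dflux g p)"
  unfolding C_def
proof (rule matrix_of_minus_div[OF assms])
  fix i assume "i \<le> npts g"
  show "dflux g p i = (\<Sum>j<npts g. dflux g (unit_vec (npts g) j) i * p $ j)"
  proof (cases "2 \<le> i \<and> i < npts g")
    case True
    then have e: "nd p i = (\<Sum>j<npts g. nd (unit_vec (npts g) j) i * p $ j)"
      "nd p (i - 1) = (\<Sum>j<npts g. nd (unit_vec (npts g) j) (i - 1) * p $ j)"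
      using nd_expand[of i "npts g" p] nd_expand[of "i - 1" "npts g" p] by auto
    show ?thesis using True unfolding dflux_def e
      by (simp add: sum_subtractf sum_distrib_left sum_divide_distrib left_diff_distrib
          diff_divide_distrib mult.assoc)
  qed (auto simp: dflux_def)
qed

end

theory Submission
  imports Defs "Jordan_Normal_Form.Determinant"
begin

text \<open>
  The implicit matrix \<open>M = I - \<gamma> A\<^sub>1\<close> is a column diagonally dominant M-matrix with unit column sums.
  In the \<open>\<ell>\<^sup>1\<close> norm this reads \<open>\<parallel>p\<parallel> \<le> \<parallel>M p\<parallel>\<close> for every \<open>\<gamma> \<ge> 0\<close> (\<open>l1_le_euler1\<close>), proved by testing
  \<open>M p\<close> against the signs of \<open>p\<close> and summing by parts.  The inequality gives everything needed about
  \<open>M\<close>: it is invertible, its inverse is \<open>\<ell>\<^sup>1\<close> nonexpansive, and, because mass is preserved,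
  \<open>M p \<ge> 0\<close> forces \<open>\<parallel>p\<parallel> \<le> \<Sum> p\<close>, that is \<open>p \<ge> 0\<close> (\<open>euler1_nonneg\<close>).

  Both limited schemes solve \<open>M p = r(p)\<close>, where \<open>r(p)\<close> is the data minus the divergence of clamped
  fluxes.  Each clamp lets at most half of a cell's content leave through each of its two interfaces,
  so \<open>r(p)\<close> is nonnegative and has the mass of the data; hence every solution is nonnegative and
  conservative.  The correction \<open>d\<close> spreads the drift flux of a node over two interfaces with weight
  one half, and each interface touches two rows, so \<open>r\<close> has \<open>\<ell>\<^sup>1\<close> Lipschitz constant at most
  \<open>2 \<gamma> \<mu> / h\<close> with \<open>\<mu>\<close> the maximal drift, which is at most 1 for \<open>\<gamma> \<le> \<gamma>\<^sub>p\<^sub>i\<^sub>c\<close>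
  (\<open>stage_rhs_nonexpansive\<close>).  Then \<open>p \<mapsto> M\<^sup>-\<^sup>1 r(p)\<close> is a bounded nonexpansive map.  At the endpoint
  \<open>\<gamma> = \<gamma>\<^sub>p\<^sub>i\<^sub>c\<close> this Lipschitz bound is 1 and Picard iteration is not covered by it, but bounded
  nonexpansive maps of a finite-dimensional space have fixed points by compactness
  (\<open>nonexpansive_fixed_point\<close>).

  For the linear maps, a positive inverse preserves nonnegativity, and the vanishing column sums of
  \<open>A\<^sub>2\<close> give conservation.  On resolved rows the clamped fluxes are the exact ones, and the
  negative divergence of the full flux is \<open>A\<^sub>2\<close>, so the rows of the limited systems are those of the unlimited
  schemes.  The orders in time follow from
  \<open>R(z) - (1 + z + z\<^sup>2/2) = - z\<^sup>4 / (2 (1 - z)\<^sup>2)\<close> and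
  \<open>r\<^sub>0\<^sub>2(z) - (1 + z + z\<^sup>2/2) = - z\<^sup>4 / (4 (1 - z + z\<^sup>2/2))\<close>.
  The thresholds combine because \<open>\<gamma>\<^sub>p\<^sub>i\<^sub>c\<close> dominates the relevant one, so every step size lies in at
  least one of the two regimes.
\<close>

unbundle no vec_syntax

section \<open>The operators in flux form and mass conservation\<close>

lemma A1_dim [simp]: "dim_row (A1 g) = npts g" "dim_col (A1 g) = npts g"
  and C_dim [simp]: "dim_row (C g) = npts g" "dim_col (C g) = npts g"
  and A2_dim [simp]: "dim_row (A2 g) = npts g" "dim_col (A2 g) = npts g"
  by (simp_all add: A2_def A1_def C_def matrix_of_def)

lemma A1_carrier [simp]: "A1 g \<in> carrier_mat (npts g) (npts g)"
  and A2_carrier [simp]: "A2 g \<in> carrier_mat (npts g) (npts g)"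
  by (rule carrier_matI; simp)+

lemma euler1_carrier [simp]: "euler1_mat g \<gamma> \<in> carrier_mat (npts g) (npts g)"
  and euler2_carrier [simp]: "euler2_mat g \<gamma> \<in> carrier_mat (npts g) (npts g)"
  and pade02_carrier [simp]: "pade02_mat g \<gamma> \<in> carrier_mat (npts g) (npts g)"
  by (rule carrier_matI; simp add: euler1_mat_def euler2_mat_def pade02_mat_def)+

lemma minus_div_carrier [simp]: "minus_div g F \<in> carrier_vec (npts g)"
  by (simp add: minus_div_def)

lemma smult_mat_vec:
  fixes A :: "real mat"
  assumes "A \<in> carrier_mat n m" "p \<in> carrier_vec m"
  shows "(c \<cdot>\<^sub>m A) *\<^sub>v p = c \<cdot>\<^sub>v (A *\<^sub>v p)"
  using assms by (intro eq_vecI) auto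

lemma euler1_apply:
  assumes "p \<in> carrier_vec (npts g)"
  shows "euler1_mat g \<gamma> *\<^sub>v p = p - \<gamma> \<cdot>\<^sub>v minus_div g (J1 g p)"
  unfolding euler1_mat_def
  using assms by (subst minus_mult_distrib_mat_vec[of _ "npts g" "npts g"])
    (auto simp: smult_mat_vec[of _ "npts g" "npts g"] A1_apply)

lemma A2_apply:
  assumes p: "p \<in> carrier_vec (npts g)"
  shows "A2 g *\<^sub>v p = minus_div g (Jtot g p)"
proof -
  have "C g \<in> carrier_mat (npts g) (npts g)" by (simp add: C_def matrix_of_def)
  then have "A2 g *\<^sub>v p = minus_div g (J1 g p) + minus_div g (dflux g p)"
    unfolding A2_def using p
    by (subst add_mult_distrib_mat_vec[of _ "npts g" "npts g"]) (auto simp: A1_apply C_apply)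
  also have "\<dots> = minus_div g (Jtot g p)"
    by (intro eq_vecI) (auto simp: minus_div_def Jtot_def diff_divide_distrib add_divide_distrib)
  finally show ?thesis .
qed

lemma euler2_apply:
  assumes "p \<in> carrier_vec (npts g)"
  shows "euler2_mat g \<gamma> *\<^sub>v p = p - \<gamma> \<cdot>\<^sub>v (A2 g *\<^sub>v p)"
  unfolding euler2_mat_def
  using assms by (subst minus_mult_distrib_mat_vec[of _ "npts g" "npts g"])
    (auto simp: smult_mat_vec[of _ "npts g" "npts g"])

lemma pade02_apply:
  assumes p: "p \<in> carrier_vec (npts g)"
  shows "pade02_mat g \<gamma> *\<^sub>v p
    = p - \<gamma> \<cdot>\<^sub>v (A2 g *\<^sub>v p) + (\<gamma>\<^sup>2 / 2) \<cdot>\<^sub>v (A2 g *\<^sub>v (A2 g *\<^sub>v p))"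
proof -
  have "pade02_mat g \<gamma> *\<^sub>v p
    = euler2_mat g \<gamma> *\<^sub>v p + ((\<gamma>\<^sup>2 / 2) \<cdot>\<^sub>m (A2 g * A2 g)) *\<^sub>v p"
    unfolding pade02_mat_def euler2_mat_def[symmetric]
    by (rule add_mult_distrib_mat_vec[OF euler2_carrier carrier_matI p]) simp_all
  moreover have "((\<gamma>\<^sup>2 / 2) \<cdot>\<^sub>m (A2 g * A2 g)) *\<^sub>v p
    = (\<gamma>\<^sup>2 / 2) \<cdot>\<^sub>v (A2 g *\<^sub>v (A2 g *\<^sub>v p))"
    using p mult_carrier_mat[OF A2_carrier A2_carrier, of g]
    by (simp add: smult_mat_vec[of _ "npts g" "npts g"]
        assoc_mult_mat_vec[of _ "npts g" "npts g" _ "npts g"])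
  ultimately show ?thesis using p by (simp add: euler2_apply)
qed

lemma J1_boundary [simp]: "J1 g p 0 = 0" "J1 g p (npts g) = 0"
  and dflux_boundary [simp]: "dflux g p 0 = 0" "dflux g p (npts g) = 0"
  and Jtot_boundary [simp]: "Jtot g p 0 = 0" "Jtot g p (npts g) = 0"
  and lamDC_boundary [simp]: "lamDC g dt b G p 0 = 0" "lamDC g dt b G p (npts g) = 0"
  by (simp_all add: J1_def dflux_def Jtot_def lamDC_def interior_def)

lemma mass_minus_div:
  assumes "F 0 = 0" "F (npts g) = 0"
  shows "mass (minus_div g F) = 0"
proof -
  have "mass (minus_div g F) = (\<Sum>k<npts g. - (F (Suc k) - F k) / mesh g)"
    by (simp add: mass_def minus_div_def)
  also have "\<dots> = - (\<Sum>k<npts g. F (Suc k) - F k) / mesh g"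
    by (simp only: sum_divide_distrib[symmetric] sum_negf)
  also have "\<dots> = 0" using assms by (simp add: sum_lessThan_telescope)
  finally show ?thesis .
qed

lemma A2_vec_carrier [simp]: "p \<in> carrier_vec (npts g) \<Longrightarrow> A2 g *\<^sub>v p \<in> carrier_vec (npts g)"
  by (simp add: A2_apply)

lemma mass_A2: "p \<in> carrier_vec (npts g) \<Longrightarrow> mass (A2 g *\<^sub>v p) = 0"
  by (simp add: A2_apply mass_minus_div)

lemma mass_add: "p \<in> carrier_vec n \<Longrightarrow> q \<in> carrier_vec n \<Longrightarrow> mass (p + q) = mass p + mass q"
  and mass_diff: "p \<in> carrier_vec n \<Longrightarrow> q \<in> carrier_vec n \<Longrightarrow> mass (p - q) = mass p - mass q"
  and mass_smult: "mass (c \<cdot>\<^sub>v p) = c * mass p"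
  by (simp_all add: mass_def sum.distrib sum_subtractf sum_distrib_left)

lemma mass_euler1: "p \<in> carrier_vec (npts g) \<Longrightarrow> mass (euler1_mat g \<gamma> *\<^sub>v p) = mass p"
  by (simp add: euler1_apply mass_diff[where n = "npts g"] mass_smult mass_minus_div)

lemma mass_euler2: "p \<in> carrier_vec (npts g) \<Longrightarrow> mass (euler2_mat g \<gamma> *\<^sub>v p) = mass p"
  by (simp add: euler2_apply mass_diff[where n = "npts g"] mass_smult mass_A2)

lemma mass_pade02: "p \<in> carrier_vec (npts g) \<Longrightarrow> mass (pade02_mat g \<gamma> *\<^sub>v p) = mass p"
  by (simp add: pade02_apply mass_add[where n = "npts g"] mass_diff[where n = "npts g"]
      mass_smult mass_A2)

section \<open>The first-order implicit matrix in the \<open>\<ell>\<^sup>1\<close> norm\<close>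

definition l1 :: "real vec \<Rightarrow> real" where
  "l1 p = (\<Sum>k<dim_vec p. \<bar>p $ k\<bar>)"

text \<open>The boundary terms drop out because boundary interfaces carry no flux.\<close>

lemma sum_by_parts:
  fixes s F :: "nat \<Rightarrow> real"
  assumes "F 0 = 0" "F n = 0"
  shows "(\<Sum>k<n. s k * (F (Suc k) - F k)) = (\<Sum>i\<in>{1..<n}. F i * (s (i - 1) - s i))"
proof (cases n)
  case (Suc m)
  have "(\<Sum>k<Suc m. s k * (F (Suc k) - F k))
      = (\<Sum>i\<in>{1..<Suc m}. F i * (s (i - 1) - s i)) + s m * F (Suc m)" for m
    by (induction m) (use assms(1) in \<open>auto simp: algebra_simps\<close>)
  from this[of m] show ?thesis using Suc assms(2) by simp
qed simp

text \<open>Test \<open>M p\<close> against the signs \<open>s\<close> of \<open>p\<close>.  The identity contributes \<open>\<parallel>p\<parallel>\<close>; after summation by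
  parts, the flux through each interface is multiplied by a jump of \<open>s\<close>.  As the flux is increasing in
  the left and decreasing in the right neighbour, these products are nonnegative.\<close>

lemma l1_le_euler1:
  assumes g: "valid_grid g" and "0 \<le> \<gamma>" and p: "p \<in> carrier_vec (npts g)"
  shows "l1 p \<le> l1 (euler1_mat g \<gamma> *\<^sub>v p)"
proof -
  let ?n = "npts g" and ?h = "mesh g" and ?M = "euler1_mat g \<gamma> *\<^sub>v p"
  define s where "s k = sgn (p $ k)" for k
  have h: "0 < ?h" using g by (simp add: valid_grid_def)
  have s1: "\<bar>s k\<bar> \<le> 1" for k by (simp add: s_def sgn_if)
  have flux: "0 \<le> J1 g p i * (s (i - 1) - s i)" if i: "i \<in> {1..<?n}" for i
  proof -
    \<comment> \<open>Upwinding: both coefficients of the interface flux have a sign.\<close>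
    define a where "a = drift g i + diffusion g i / ?h"
    define c where "c = diffusion g (i + 1) / ?h"
    have ac: "0 \<le> a" "0 \<le> c"
      using g h i by (auto simp: valid_grid_def a_def c_def less_imp_le)
    have J: "J1 g p i = a * p $ (i - 1) - c * p $ i"
      using i by (simp add: J1_def interior_def nd_def a_def c_def diff_divide_distrib algebra_simps)
    have le: "s k * p $ l \<le> s l * p $ l" for k l
      using s1[of k] by (auto simp: s_def sgn_if split: if_splits)
    have "J1 g p i * (s (i - 1) - s i)
      = a * (s (i - 1) * p $ (i - 1) - s i * p $ (i - 1)) + c * (s i * p $ i - s (i - 1) * p $ i)"
      by (simp add: J algebra_simps)
    then show ?thesis using ac le[of i "i - 1"] le[of "i - 1" i] by simp
  qed
  have parts: "(\<Sum>k<?n. s k * (J1 g p (Suc k) - J1 g p k)) \<ge> 0"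
    by (subst sum_by_parts) (auto intro!: sum_nonneg intro: flux[simplified])
  have "l1 p = (\<Sum>k<?n. s k * p $ k)"
    using p by (auto simp: l1_def s_def sgn_if intro!: sum.cong)
  also have "\<dots> \<le> (\<Sum>k<?n. s k * p $ k) + \<gamma> / ?h * (\<Sum>k<?n. s k * (J1 g p (Suc k) - J1 g p k))"
    using parts h \<open>0 \<le> \<gamma>\<close> by simp
  also have "\<dots> = (\<Sum>k<?n. s k * ?M $ k)"
    unfolding sum_distrib_left sum.distrib[symmetric]
    using p h by (intro sum.cong) (auto simp: euler1_apply minus_div_def field_simps)
  also have "\<dots> \<le> (\<Sum>k<?n. \<bar>?M $ k\<bar>)"
  proof (rule sum_mono)
    fix k
    have "s k * ?M $ k \<le> \<bar>s k\<bar> * \<bar>?M $ k\<bar>" by (metis abs_ge_self abs_mult)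
    also have "\<dots> \<le> \<bar>?M $ k\<bar>" using s1[of k] by (simp add: mult_left_le_one_le)
    finally show "s k * ?M $ k \<le> \<bar>?M $ k\<bar>" .
  qed
  also have "\<dots> = l1 ?M" using p by (simp add: l1_def euler1_apply minus_div_def)
  finally show ?thesis .
qed

text \<open>This is the inverse positivity of an M-matrix.  Since \<open>M p \<ge> 0\<close>, its \<open>\<ell>\<^sup>1\<close> norm is its mass, which is the
  mass of \<open>p\<close>; so \<open>\<parallel>p\<parallel> \<le> \<Sum> p\<close>, and no entry of \<open>p\<close> can be negative.\<close>

lemma euler1_nonneg:
  assumes "valid_grid g" "0 \<le> \<gamma>" and p: "p \<in> carrier_vec (npts g)"
    and nn: "nonneg_vec (euler1_mat g \<gamma> *\<^sub>v p)"
  shows "nonneg_vec p"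
proof -
  have "l1 p \<le> mass (euler1_mat g \<gamma> *\<^sub>v p)"
    using l1_le_euler1[OF assms(1-3)] nn by (simp add: l1_def mass_def nonneg_vec_def)
  then have "l1 p \<le> mass p" by (simp add: mass_euler1 p)
  then have "(\<Sum>k<dim_vec p. \<bar>p $ k\<bar> - p $ k) \<le> 0" by (simp add: l1_def mass_def sum_subtractf)
  moreover have "0 \<le> (\<Sum>k<dim_vec p. \<bar>p $ k\<bar> - p $ k)" by (intro sum_nonneg) simp
  ultimately have "(\<Sum>k<dim_vec p. \<bar>p $ k\<bar> - p $ k) = 0" by simp
  then have "\<forall>k<dim_vec p. \<bar>p $ k\<bar> - p $ k = 0" by (subst (asm) sum_nonneg_eq_0_iff) auto
  then show ?thesis by (auto simp: nonneg_vec_def)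
qed

lemma euler1_inverse:
  assumes "valid_grid g" "0 \<le> \<gamma>"
  obtains B where "B \<in> carrier_mat (npts g) (npts g)"
    "euler1_mat g \<gamma> * B = 1\<^sub>m (npts g)"
proof -
  let ?n = "npts g" and ?M = "euler1_mat g \<gamma>"
  have "v = 0\<^sub>v ?n" if v: "v \<in> carrier_vec ?n" and 0: "?M *\<^sub>v v = 0\<^sub>v ?n" for v
  proof -
    have "(\<Sum>k<?n. \<bar>v $ k\<bar>) \<le> 0"
      using l1_le_euler1[OF assms v] v unfolding 0 by (simp add: l1_def)
    then have "(\<Sum>k<?n. \<bar>v $ k\<bar>) = 0" by (simp add: order_antisym sum_nonneg)
    then have "\<forall>k<?n. v $ k = 0" by (subst (asm) sum_nonneg_eq_0_iff) auto
    then show ?thesis using v by (intro eq_vecI) auto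
  qed
  then have "Determinant.det ?M \<noteq> 0" using det_0_iff_vec_prod_zero_field[of ?M ?n] by auto
  then have "?M \<in> Units (ring_mat TYPE(real) ?n ())" by (intro det_non_zero_imp_unit) auto
  then obtain B where "mat_inverse ?M = Some B"
    using mat_inverse(1)[of ?M ?n "()"] by (cases "mat_inverse ?M") auto
  then show ?thesis using mat_inverse(2)[of ?M ?n B] that by auto
qed

section \<open>Fixed points of bounded nonexpansive maps\<close>

text \<open>For \<open>0 \<le> \<theta> < 1\<close> the map \<open>\<theta> T\<close> is a strict contraction of the compact cube of radius \<open>R\<close>, so it has a
  fixed point \<open>y\<close>, at which \<open>T\<close> displaces by at most \<open>(1 - \<theta>) n R\<close>.  Letting \<open>\<theta> \<rightarrow> 1\<close>, the displacement of \<open>T\<close> has infimum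
  zero on the cube, and by compactness it is attained.\<close>

lemma nonexpansive_fixed_point:
  fixes T :: "real vec \<Rightarrow> real vec"
  assumes carrier: "\<And>p. p \<in> carrier_vec n \<Longrightarrow> T p \<in> carrier_vec n"
    and nonexp: "\<And>p q. p \<in> carrier_vec n \<Longrightarrow> q \<in> carrier_vec n \<Longrightarrow> l1 (T p - T q) \<le> l1 (p - q)"
    and bound: "\<And>p k. p \<in> carrier_vec n \<Longrightarrow> k < n \<Longrightarrow> \<bar>T p $ k\<bar> \<le> R"
    and "0 \<le> R"
  shows "\<exists>p\<in>carrier_vec n. T p = p"
proof -
  \<comment> \<open>The dimension is a number and not a type, so the topology is taken from sequences: \<open>K\<close> is a
    Tychonoff cube and \<open>U\<close> is \<open>T\<close> acting on the first \<open>n\<close> coordinates.\<close>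
  define K :: "(nat \<Rightarrow> real) set" where "K = (UNIV \<rightarrow>\<^sub>E {-R..R})"
  define d where "d x y = (\<Sum>i<n. \<bar>x i - y i\<bar>)" for x y :: "nat \<Rightarrow> real"
  define U where "U x k = (if k < n then T (vec n x) $ k else 0)" for x k
  have compK: "compact K"
    using compactin_PiE[of "\<lambda>_::nat. euclidean::real topology" UNIV "\<lambda>_. {-R..R}"]
    by (simp add: K_def euclidean_product_topology)
  have K0: "(\<lambda>_. 0) \<in> K" using \<open>0 \<le> R\<close> by (auto simp: K_def)
  have UK: "\<theta> * U x k \<in> {-R..R}" if "0 \<le> \<theta>" "\<theta> \<le> 1" for x k \<theta>
  proof -
    have "\<bar>U x k\<bar> \<le> R" using bound[of "vec n x" k] \<open>0 \<le> R\<close> by (simp add: U_def)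
    moreover have "\<bar>\<theta> * U x k\<bar> \<le> \<bar>U x k\<bar>" using that by (simp add: abs_mult mult_left_le_one_le)
    ultimately show ?thesis by (simp add: abs_le_iff) linarith
  qed
  have dU: "d (U x) (U y) \<le> d x y" for x y
  proof -
    have "dim_vec (T (vec n x)) = n" for x using carrier[of "vec n x"] by simp
    then show ?thesis using nonexp[of "vec n x" "vec n y"] by (simp add: l1_def d_def U_def)
  qed
  have contU: "continuous_on UNIV (\<lambda>x. U x k)" if "k < n" for k
  proof (simp add: continuous_on_def, intro allI)
    fix x
    have "((\<lambda>y. d y x) \<longlongrightarrow> d x x) (at x)"
    proof -
      have "continuous_on UNIV (\<lambda>y. d y x)"
        unfolding d_def by (intro continuous_intros) simp
      then show ?thesis by (simp add: continuous_on_def)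
    qed
    then have lim: "((\<lambda>y. d y x) \<longlongrightarrow> 0) (at x)" by (simp add: d_def)
    have "norm (U y k - U x k) \<le> d y x" for y
    proof -
      have "\<bar>U y k - U x k\<bar> \<le> d (U y) (U x)"
        unfolding d_def using that by (intro member_le_sum) auto
      then show ?thesis using dU[of y x] by simp
    qed
    then have "((\<lambda>y. U y k - U x k) \<longlongrightarrow> 0) (at x)"
      by (intro Lim_null_comparison[OF _ lim]) simp
    then show "((\<lambda>y. U y k) \<longlongrightarrow> U x k) (at x)" by (simp add: LIM_zero_iff)
  qed
  have contd: "continuous_on K (\<lambda>x. d (\<lambda>k. \<theta> * U x k) x)" for \<theta>
    unfolding d_def
  proof (intro continuous_on_sum continuous_on_rabs continuous_on_diff continuous_on_mult
      continuous_on_const)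
    fix k assume "k \<in> {..<n}"
    then show "continuous_on K (\<lambda>x. U x k)" by (intro continuous_on_subset[OF contU]) auto
    show "continuous_on K (\<lambda>x. x k)"
      by (rule continuous_on_subset[OF continuous_on_product_coordinates]) simp
  qed
  \<comment> \<open>Applying a strict contraction to a minimiser of the displacement would decrease the
    displacement unless it were already zero.\<close>
  have strict: "\<exists>x\<in>K. d (\<lambda>k. \<theta> * U x k) x = 0" if \<theta>: "0 \<le> \<theta>" "\<theta> < 1" for \<theta>
  proof -
    obtain x where x: "x \<in> K"
      and min: "\<And>y. y \<in> K \<Longrightarrow> d (\<lambda>k. \<theta> * U x k) x \<le> d (\<lambda>k. \<theta> * U y k) y"
      using continuous_attains_inf[OF compK _ contd[of \<theta>]] K0 by blast
    let ?y = "\<lambda>k. \<theta> * U x k"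
    have "?y \<in> K" using UK[of \<theta> x] \<theta> by (auto simp: K_def)
    then have "d ?y x \<le> d (\<lambda>k. \<theta> * U ?y k) ?y" by (rule min)
    also have "\<dots> = \<theta> * d (U ?y) (U x)"
      using \<theta> by (simp add: d_def sum_distrib_left abs_mult flip: right_diff_distrib)
    also have "\<dots> \<le> \<theta> * d ?y x" using dU \<theta> by (intro mult_left_mono) auto
    finally have "(1 - \<theta>) * d ?y x \<le> 0" by (simp add: algebra_simps)
    moreover have "0 \<le> d ?y x" by (simp add: d_def sum_nonneg)
    ultimately have "d ?y x = 0" using \<theta> by (smt (verit) mult_pos_pos)
    then show ?thesis using x by blast
  qed
  obtain x where x: "x \<in> K" and min: "\<And>y. y \<in> K \<Longrightarrow> d (U x) x \<le> d (U y) y"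
    using continuous_attains_inf[OF compK _ contd[of 1]] K0 by (auto simp: )
  have small: "d (U x) x \<le> e * (real n * R)" if e: "0 < e" "e \<le> 1" for e
  proof -
    obtain y where y: "y \<in> K" "d (\<lambda>k. (1 - e) * U y k) y = 0"
      using strict[of "1 - e"] e by auto
    then have fp: "\<And>k. k < n \<Longrightarrow> (1 - e) * U y k = y k"
      unfolding d_def by (subst (asm) sum_nonneg_eq_0_iff) auto
    have "d (U x) x \<le> d (U y) y" by (rule min[OF y(1)])
    also have "\<dots> = (\<Sum>k<n. e * \<bar>U y k\<bar>)"
      unfolding d_def
    proof (intro sum.cong refl)
      fix k assume "k \<in> {..<n}"
      then have "U y k - y k = e * U y k" using fp[of k] by (simp add: algebra_simps)
      then show "\<bar>U y k - y k\<bar> = e * \<bar>U y k\<bar>" using e by (simp add: abs_mult)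
    qed
    also have "\<dots> \<le> (\<Sum>k<n. e * R)"
      using UK[of 1 y] e by (intro sum_mono mult_left_mono) (auto simp: abs_le_iff minus_le_iff)
    finally show ?thesis by (simp add: mult.left_commute)
  qed
  have "d (U x) x \<le> 0"
  proof (rule tendsto_lowerbound)
    show "((\<lambda>e. e * (real n * R)) \<longlongrightarrow> 0) (at_right 0)"
      by (auto intro!: tendsto_eq_intros)
    show "\<forall>\<^sub>F e in at_right 0. d (U x) x \<le> e * (real n * R)"
      using small by (auto simp: eventually_at_right_field intro!: exI[of _ 1])
  qed simp
  moreover have "0 \<le> d (U x) x" by (simp add: d_def sum_nonneg)
  ultimately have "d (U x) x = 0" by simp
  then have "\<forall>k<n. U x k = x k" unfolding d_def by (subst (asm) sum_nonneg_eq_0_iff) auto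
  then have "T (vec n x) = vec n x"
    using carrier[of "vec n x"] by (intro eq_vecI) (auto simp: U_def)
  then show ?thesis by (intro bexI[of _ "vec n x"]) auto
qed

section \<open>Solvability and positivity of a limited stage\<close>

definition stage_rhs ::
  "fp_grid \<Rightarrow> real \<Rightarrow> real vec \<Rightarrow> (nat \<Rightarrow> real) \<Rightarrow> real vec \<Rightarrow> real vec" where
  "stage_rhs g dt b G p = b + minus_div g (lamDC g dt b G p)"

lemma stage_rhs_carrier [simp]:
  "b \<in> carrier_vec (npts g) \<Longrightarrow> stage_rhs g dt b G p \<in> carrier_vec (npts g)"
  by (simp add: stage_rhs_def)

lemma vec_diff_eq_0_iff:
  fixes x y :: "real vec"
  assumes "x \<in> carrier_vec n" "y \<in> carrier_vec n"
  shows "x - y = 0\<^sub>v n \<longleftrightarrow> x = y"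
  using assms by (auto simp: vec_eq_iff)

lemma limited_stage_iff:
  assumes "b \<in> carrier_vec (npts g)"
  shows "limited_stage g dt b G p \<longleftrightarrow>
    p \<in> carrier_vec (npts g) \<and> euler1_mat g dt *\<^sub>v p = stage_rhs g dt b G p"
proof -
  have "euler1_mat g dt *\<^sub>v p \<in> carrier_vec (npts g)" if "p \<in> carrier_vec (npts g)"
    using that by (rule mult_mat_vec_carrier[OF euler1_carrier])
  then show ?thesis
    using assms vec_diff_eq_0_iff[of "euler1_mat g dt *\<^sub>v p" "npts g" "stage_rhs g dt b G p"]
    by (auto simp: limited_stage_def stage_residual_def stage_rhs_def[symmetric])
qed

lemma mass_stage_rhs:
  "b \<in> carrier_vec (npts g) \<Longrightarrow> mass (stage_rhs g dt b G p) = mass b"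
  by (simp add: stage_rhs_def mass_add[where n = "npts g"] mass_minus_div)

text \<open>The clamps allow at most half of the content of a cell to leave through either of its interfaces.\<close>

lemma nonneg_stage_rhs:
  assumes g: "valid_grid g" and b: "b \<in> nonneg_data g"
  shows "nonneg_vec (stage_rhs g dt b G p)"
  unfolding nonneg_vec_def
proof (intro allI impI)
  have h: "0 < mesh g" using g by (simp add: valid_grid_def)
  have dim: "dim_vec b = npts g" and b0: "\<And>k. k < npts g \<Longrightarrow> 0 \<le> b $ k"
    using b by (auto simp: nonneg_data_def nonneg_vec_def)
  fix k assume "k < dim_vec (stage_rhs g dt b G p)"
  then have k: "k < npts g" by (simp add: stage_rhs_def minus_div_def)
  have up: "lamDC g dt b G p (k + 1) \<le> mesh g * b $ k / 2"
  proof (cases "interior g (k + 1)")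
    case True
    then have "0 \<le> mesh g * b $ k / 2" "0 \<le> mesh g * b $ (k + 1) / 2"
      using b0[of k] b0[of "k + 1"] h by (auto simp: interior_def)
    then show ?thesis using True by (auto simp: lamDC_def clamp_to_def nd_def simp del: le_divide_eq_numeral1)
  qed (use b0[of k] k h in \<open>simp add: lamDC_def\<close>)
  have lo: "- (mesh g * b $ k / 2) \<le> lamDC g dt b G p k"
    using b0[of k] k h by (auto simp: lamDC_def clamp_to_def nd_def)
  have "lamDC g dt b G p (k + 1) - lamDC g dt b G p k \<le> mesh g * b $ k"
    using up lo by simp
  then show "0 \<le> stage_rhs g dt b G p $ k"
    using h k dim by (simp add: stage_rhs_def minus_div_def field_simps)
qed

lemma clamp_to_lipschitz: "\<bar>clamp_to lo hi x - clamp_to lo hi y\<bar> \<le> \<bar>x - y\<bar>"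
  by (auto simp: clamp_to_def)

lemma drift_le_mubar:
  assumes "valid_grid g" "i \<in> {1..npts g}"
  shows "drift g i \<le> mubar g"
  unfolding mubar_def using assms
  by (intro order_trans[OF abs_ge_self Max_ge]) auto

lemma mubar_pos: "valid_grid g \<Longrightarrow> 0 < mubar g"
  using drift_le_mubar[of g 1] by (force simp: valid_grid_def)

text \<open>The entry of \<open>p\<close> at a node enters two interface corrections with weight at most \<open>\<mu>/2\<close>, \<open>\<mu>\<close> the maximal drift, and
  each of them enters two rows with weight \<open>dt/h\<close>: the total is \<open>2 dt \<mu> / h\<close>, at most 1 for
  \<open>dt \<le> \<gamma>\<^sub>p\<^sub>i\<^sub>c\<close>.  Clamping to bounds independent of \<open>p\<close> does not increase differences.\<close>

lemma stage_rhs_nonexpansive: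
  assumes g: "valid_grid g" and dt: "0 \<le> dt" "dt \<le> gamma_pic g"
    and b: "b \<in> carrier_vec (npts g)"
    and p: "p \<in> carrier_vec (npts g)" and q: "q \<in> carrier_vec (npts g)"
  shows "l1 (stage_rhs g dt b G p - stage_rhs g dt b G q) \<le> l1 (p - q)"
proof -
  let ?n = "npts g" and ?h = "mesh g" and ?m = "mubar g"
  define r where "r k = \<bar>p $ k - q $ k\<bar>" for k
  define L where "L i = \<bar>lamDC g dt b G p i - lamDC g dt b G q i\<bar>" for i
  have h: "0 < ?h" using g by (simp add: valid_grid_def)
  have m: "0 < ?m" by (rule mubar_pos[OF g])
  have L0: "L 0 = 0" "L ?n = 0" by (simp_all add: L_def)
  \<comment> \<open>Nodes start at 1 and entries at 0, so interface \<open>i\<close> sees the entries \<open>i - 1\<close> and \<open>i - 2\<close>; the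
    case distinctions keep truncated subtraction from counting entry 0 twice.\<close>
  have Lb: "L i \<le> dt * ?m / 2 * ((if i < ?n then r (i - 1) else 0) + (if 2 \<le> i then r (i - 2) else 0))"
    if i: "i \<in> {1..?n}" for i
  proof (cases "2 \<le> i \<and> i < ?n")
    case True
    have r0: "0 \<le> r k" for k by (simp add: r_def)
    have "i \<in> {1..?n}" "i - 1 \<in> {1..?n}" using True by auto
    then have mu: "0 \<le> drift g i" "drift g i \<le> ?m" "0 \<le> drift g (i - 1)" "drift g (i - 1) \<le> ?m"
      using drift_le_mubar[OF g] g by (blast intro: less_imp_le dest: valid_grid_def[THEN iffD1])+
    have int: "interior g i" using True by (simp add: interior_def)
    have i1: "i - Suc (Suc 0) = i - 2" by simp
    have "L i \<le> \<bar>(dt * dflux g p i + G i) - (dt * dflux g q i + G i)\<bar>"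
      unfolding L_def lamDC_def if_P[OF int] by (rule clamp_to_lipschitz)
    also have "\<dots> = dt / 2 * \<bar>drift g i * (p $ (i - 1) - q $ (i - 1))
        - drift g (i - 1) * (p $ (i - 2) - q $ (i - 2))\<bar>"
    proof -
      have "(dt * dflux g p i + G i) - (dt * dflux g q i + G i)
        = dt / 2 * (drift g i * (p $ (i - 1) - q $ (i - 1))
        - drift g (i - 1) * (p $ (i - 2) - q $ (i - 2)))"
        using True by (simp add: dflux_def nd_def i1 algebra_simps)
      from arg_cong[OF this, of abs] show ?thesis using dt by (simp only: abs_mult) simp
    qed
    also have "\<dots> \<le> dt / 2 * (drift g i * r (i - 1) + drift g (i - 1) * r (i - 2))"
    proof (rule mult_left_mono)
      have "\<bar>x - y\<bar> \<le> \<bar>x\<bar> + \<bar>y\<bar>" for x y :: real by simp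
      then show "\<bar>drift g i * (p $ (i - 1) - q $ (i - 1))
          - drift g (i - 1) * (p $ (i - 2) - q $ (i - 2))\<bar>
        \<le> drift g i * r (i - 1) + drift g (i - 1) * r (i - 2)"
        using mu unfolding r_def by (metis abs_mult abs_of_nonneg)
    qed (use dt in simp)
    also have "\<dots> \<le> dt / 2 * (?m * r (i - 1) + ?m * r (i - 2))"
      using mu r0 dt by (intro mult_left_mono add_mono mult_right_mono) auto
    finally show ?thesis using True by (simp add: algebra_simps)
  next
    case False
    then have "lamDC g dt b G p i = lamDC g dt b G q i"
      by (auto simp: lamDC_def dflux_def)
    then show ?thesis using dt m by (simp add: L_def r_def)
  qed
  have "l1 (stage_rhs g dt b G p - stage_rhs g dt b G q)
      \<le> (\<Sum>k<?n. (L (Suc k) + L k) / ?h)"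
    unfolding l1_def
  proof (rule order_trans[OF eq_refl sum_mono])
    show "(\<Sum>k<dim_vec (stage_rhs g dt b G p - stage_rhs g dt b G q).
        \<bar>(stage_rhs g dt b G p - stage_rhs g dt b G q) $ k\<bar>)
      = (\<Sum>k<?n. \<bar>(stage_rhs g dt b G p - stage_rhs g dt b G q) $ k\<bar>)"
      by (simp add: stage_rhs_def minus_div_def)
    fix k assume "k \<in> {..<?n}"
    then have "(stage_rhs g dt b G p - stage_rhs g dt b G q) $ k
      = ((lamDC g dt b G p k - lamDC g dt b G q k)
         - (lamDC g dt b G p (Suc k) - lamDC g dt b G q (Suc k))) / ?h"
      using b h by (simp add: stage_rhs_def minus_div_def field_simps)
    then show "\<bar>(stage_rhs g dt b G p - stage_rhs g dt b G q) $ k\<bar> \<le> (L (Suc k) + L k) / ?h"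
      unfolding L_def using h by (simp add: divide_right_mono)
  qed
  also have "\<dots> = 2 / ?h * (\<Sum>k<?n. L (Suc k))"
  proof -
    have "(\<Sum>k<?n. L (Suc k)) = (\<Sum>k<?n. L k)"
      using sum_lessThan_telescope[of L ?n] L0 by (simp add: sum_subtractf)
    then show ?thesis by (simp add: sum.distrib flip: sum_divide_distrib)
  qed
  also have "\<dots> \<le> 2 / ?h * (\<Sum>k<?n. dt * ?m / 2 *
      ((if Suc k < ?n then r k else 0) + (if 1 \<le> k then r (k - 1) else 0)))"
  proof (intro mult_left_mono sum_mono)
    fix k assume "k \<in> {..<?n}"
    then show "L (Suc k) \<le> dt * ?m / 2 *
      ((if Suc k < ?n then r k else 0) + (if 1 \<le> k then r (k - 1) else 0))"
      using Lb[of "Suc k"] by (cases k) (simp_all split: if_splits)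
  qed (use h in simp)
  also have "\<dots> = dt * ?m / ?h * ((\<Sum>k<?n. if Suc k < ?n then r k else 0)
      + (\<Sum>k<?n. if 1 \<le> k then r (k - 1) else 0))"
    by (simp only: sum_distrib_left[symmetric] sum.distrib) simp
  also have "\<dots> \<le> dt * ?m / ?h * ((\<Sum>k<?n. r k) + (\<Sum>k<?n. r k))"
  proof (intro mult_left_mono add_mono)
    show "(\<Sum>k<?n. if Suc k < ?n then r k else 0) \<le> (\<Sum>k<?n. r k)"
      by (intro sum_mono) (simp add: r_def)
    have "(\<Sum>k<?n. if 1 \<le> k then r (k - 1) else 0) = (\<Sum>k<?n - 1. r k)"
      by (cases ?n) (simp_all add: sum.lessThan_Suc_shift del: sum.lessThan_Suc)
    also have "\<dots> \<le> (\<Sum>k<?n. r k)" by (intro sum_mono2) (auto simp: r_def)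
    finally show "(\<Sum>k<?n. if 1 \<le> k then r (k - 1) else 0) \<le> (\<Sum>k<?n. r k)" .
  qed (use dt m h in auto)
  also have "\<dots> = 2 * dt * ?m / ?h * (\<Sum>k<?n. r k)" by simp
  also have "\<dots> \<le> 1 * (\<Sum>k<?n. r k)"
    using dt(2) h m by (intro mult_right_mono sum_nonneg) (auto simp: gamma_pic_def r_def field_simps)
  also have "\<dots> = l1 (p - q)" using p q by (simp add: l1_def r_def)
  finally show ?thesis .
qed

text \<open>The bound for the fixed point argument comes from positivity and conservation: the entries of a nonnegative
  vector are at most its mass, which is that of \<open>b\<close>.\<close>

lemma limited_stage_exists:
  assumes g: "valid_grid g" and dt: "0 \<le> dt" "dt \<le> gamma_pic g" and b: "b \<in> nonneg_data g"
  shows "\<exists>p. limited_stage g dt b G p"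
proof -
  let ?n = "npts g" and ?M = "euler1_mat g dt"
  have bc: "b \<in> carrier_vec ?n" using b by (simp add: nonneg_data_def)
  obtain B where B: "B \<in> carrier_mat ?n ?n" "?M * B = 1\<^sub>m ?n" using euler1_inverse[OF g dt(1)] .
  have MB: "?M *\<^sub>v (B *\<^sub>v c) = c" if "c \<in> carrier_vec ?n" for c
    using that B by (simp flip: assoc_mult_mat_vec[of _ ?n ?n _ ?n])
  define T where "T p = B *\<^sub>v stage_rhs g dt b G p" for p
  have Tc: "T p \<in> carrier_vec ?n" for p
    unfolding T_def using B(1) bc by (intro mult_mat_vec_carrier[of _ ?n ?n]) auto
  have MT: "?M *\<^sub>v T p = stage_rhs g dt b G p" for p unfolding T_def by (rule MB) (simp add: bc)
  have "\<exists>p\<in>carrier_vec ?n. T p = p"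
  proof (rule nonexpansive_fixed_point)
    fix p q :: "real vec" assume pq: "p \<in> carrier_vec ?n" "q \<in> carrier_vec ?n"
    have "l1 (T p - T q) \<le> l1 (?M *\<^sub>v (T p - T q))"
      using Tc by (intro l1_le_euler1[OF g dt(1)]) auto
    also have "?M *\<^sub>v (T p - T q) = stage_rhs g dt b G p - stage_rhs g dt b G q"
      using Tc by (simp add: mult_minus_distrib_mat_vec[of _ ?n ?n] MT)
    also have "l1 \<dots> \<le> l1 (p - q)" by (rule stage_rhs_nonexpansive[OF g dt bc pq])
    finally show "l1 (T p - T q) \<le> l1 (p - q)" .
  next
    fix p :: "real vec" and k assume k: "k < ?n"
    have nn: "nonneg_vec (T p)"
      using euler1_nonneg[OF g dt(1) Tc] nonneg_stage_rhs[OF g b] by (simp add: MT)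
    have dim: "dim_vec (T p) = ?n" using Tc[of p] by simp
    have "T p $ k \<le> mass (T p)"
      unfolding mass_def using nn k dim by (intro member_le_sum) (auto simp: nonneg_vec_def)
    also have "\<dots> = mass b"
      using mass_euler1[OF Tc, of dt p] mass_stage_rhs[OF bc] by (simp add: MT)
    finally show "\<bar>T p $ k\<bar> \<le> mass b" using nn k dim by (simp add: nonneg_vec_def)
  next
    show "0 \<le> mass b" using b by (auto simp: mass_def nonneg_data_def nonneg_vec_def intro!: sum_nonneg)
  qed (rule Tc)
  then show ?thesis using MT bc by (metis limited_stage_iff)
qed

lemma limited_stage_props:
  assumes g: "valid_grid g" and dt: "0 \<le> dt" and b: "b \<in> nonneg_data g"
    and p: "limited_stage g dt b G p"
  shows "p \<in> carrier_vec (npts g) \<and> nonneg_vec p \<and> mass p = mass b"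
proof -
  have bc: "b \<in> carrier_vec (npts g)" using b by (simp add: nonneg_data_def)
  have pc: "p \<in> carrier_vec (npts g)" and e: "euler1_mat g dt *\<^sub>v p = stage_rhs g dt b G p"
    using p bc by (auto simp: limited_stage_iff)
  show ?thesis
    using pc euler1_nonneg[OF g dt pc] nonneg_stage_rhs[OF g b] mass_euler1[OF pc, of dt]
      mass_stage_rhs[OF bc] by (simp add: e)
qed

section \<open>The limited schemes\<close>

text \<open>Multiplication by \<open>\<gamma> > 0\<close> commutes with clamping, so FCDF-B is the predictor stage of FCDF-DC.\<close>

lemma fcdfB_residual_eq_stage:
  assumes "0 < \<gamma>" "b \<in> carrier_vec (npts g)"
  shows "fcdfB_residual g \<gamma> b p = stage_residual g \<gamma> b (\<lambda>i. 0) p"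
proof -
  have "\<gamma> * lamB g \<gamma> b p i = lamDC g \<gamma> b (\<lambda>i. 0) p i" for i
  proof (cases "interior g i")
    case True
    have "\<gamma> * clamp_to lo hi x = clamp_to (\<gamma> * lo) (\<gamma> * hi) (\<gamma> * x)" for lo hi x
      using assms(1) by (simp add: clamp_to_def max_mult_distrib_left min_mult_distrib_left)
    then show ?thesis using True assms(1) by (simp add: lamB_def lamDC_def)
  qed (simp add: lamB_def lamDC_def)
  then have e: "lamDC g \<gamma> b (\<lambda>i. 0) p = (\<lambda>i. \<gamma> * lamB g \<gamma> b p i)" by auto
  have "\<gamma> \<cdot>\<^sub>v minus_div g (lamB g \<gamma> b p) = minus_div g (lamDC g \<gamma> b (\<lambda>i. 0) p)"
    by (intro eq_vecI) (auto simp: e minus_div_def diff_divide_distrib algebra_simps)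
  then show ?thesis by (simp add: fcdfB_residual_def stage_residual_def)
qed

lemma fcdfB_iff_stage:
  assumes "0 < \<gamma>" "b \<in> nonneg_data g"
  shows "fcdfB g \<gamma> b p \<longleftrightarrow> limited_stage g \<gamma> b (\<lambda>i. 0) p"
  using assms fcdfB_residual_eq_stage[of \<gamma> b g p]
  by (auto simp: fcdfB_def limited_stage_def nonneg_data_def)

lemma realization_FCDF_B:
  assumes g: "valid_grid g" and \<gamma>: "0 < \<gamma>" "\<gamma> \<le> gamma_pic g"
  shows "realization g FCDF_B \<gamma>"
proof -
  have "same_row (fcdfB_residual g \<gamma> b p) (euler2_residual g \<gamma> b p) k"
    if b: "b \<in> nonneg_data g" and p: "fcdfB g \<gamma> b p" and k: "k < npts g"
      and res: "resolvedB g \<gamma> b p k" for b p k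
  proof -
    have pc: "p \<in> carrier_vec (npts g)" and z: "fcdfB_residual g \<gamma> b p $ k = 0"
      using p k by (auto simp: fcdfB_def)
    have bc: "dim_vec b = npts g" using b by (simp add: nonneg_data_def)
    have "fcdfB_residual g \<gamma> b p $ k = euler2_residual g \<gamma> b p $ k"
      using res pc bc k
      by (simp add: fcdfB_residual_def euler2_residual_def euler1_apply euler2_apply A2_apply
          minus_div_def Jtot_def resolvedB_def diff_divide_distrib add_divide_distrib algebra_simps)
    then show ?thesis using z by (simp add: same_row_def)
  qed
  then have "second_order_space g FCDF_B \<gamma>" by simp
  moreover have "\<exists>p. step g FCDF_B \<gamma> b p" if "b \<in> nonneg_data g" for b
    using limited_stage_exists[OF g less_imp_le[OF \<gamma>(1)] \<gamma>(2) that]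
    by (simp add: fcdfB_iff_stage[OF \<gamma>(1) that])
  moreover have "p \<in> carrier_vec (npts g) \<and> nonneg_vec p \<and> mass p = mass b"
    if "b \<in> nonneg_data g" "step g FCDF_B \<gamma> b p" for b p
    using limited_stage_props[OF g less_imp_le[OF \<gamma>(1)] that(1)] that(2)
    by (simp add: fcdfB_iff_stage[OF \<gamma>(1) that(1)])
  ultimately show ?thesis unfolding realization_def by blast
qed

lemma stage_residual_row:
  assumes pc: "p \<in> carrier_vec (npts g)" and bc: "b \<in> carrier_vec (npts g)" and k: "k < npts g"
    and res: "resolved_stage g dt b G p k"
  shows "stage_residual g dt b G p $ k
    = (euler2_mat g dt *\<^sub>v p) $ k - (b $ k + minus_div g G $ k)"
  using res pc bc k
  by (simp add: stage_residual_def euler1_apply euler2_apply A2_apply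
      minus_div_def Jtot_def resolved_stage_def diff_divide_distrib add_divide_distrib algebra_simps)

lemma minus_div_Gcorr:
  assumes "Y \<in> carrier_vec (npts g)"
  shows "minus_div g (Gcorr g dt Y) = - (dt\<^sup>2 / 2) \<cdot>\<^sub>v (A2 g *\<^sub>v (A2 g *\<^sub>v Y))"
proof -
  have "A2 g *\<^sub>v Y \<in> carrier_vec (npts g)" using assms by (simp add: A2_apply)
  then show ?thesis
    by (simp add: A2_apply[of "A2 g *\<^sub>v Y"])
      (intro eq_vecI, auto simp: minus_div_def Gcorr_def diff_divide_distrib algebra_simps)
qed

lemma realization_FCDF_DC:
  assumes g: "valid_grid g" and \<gamma>: "0 < \<gamma>" "\<gamma> \<le> gamma_pic g"
  shows "realization g FCDF_DC \<gamma>"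
proof -
  have sos: "same_row (stage_residual g \<gamma> b (\<lambda>i. 0) Y) (euler2_residual g \<gamma> b Y) k \<and>
      same_row (stage_residual g \<gamma> b (Gcorr g \<gamma> Y) p) (corr2_residual g \<gamma> b Y p) k"
    if b: "b \<in> nonneg_data g" and st: "fcdfDC g \<gamma> b Y p" and k: "k < npts g"
      and res: "resolvedDC g \<gamma> b Y p k" for b Y p k
  proof -
    have bc: "b \<in> carrier_vec (npts g)" using b by (simp add: nonneg_data_def)
    have Y: "Y \<in> carrier_vec (npts g)" "stage_residual g \<gamma> b (\<lambda>i. 0) Y $ k = 0"
      and p: "p \<in> carrier_vec (npts g)" "stage_residual g \<gamma> b (Gcorr g \<gamma> Y) p $ k = 0"
      using st k by (auto simp: fcdfDC_def limited_stage_def)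
    have AAY: "A2 g *\<^sub>v (A2 g *\<^sub>v Y) \<in> carrier_vec (npts g)"
      using Y by (intro mult_mat_vec_carrier[of _ "npts g" "npts g"]) (auto simp: A2_apply)
    have "stage_residual g \<gamma> b (\<lambda>i. 0) Y $ k = euler2_residual g \<gamma> b Y $ k"
      using res bc k by (subst stage_residual_row[OF Y(1) bc k])
        (auto simp: resolvedDC_def euler2_residual_def minus_div_def)
    moreover have "stage_residual g \<gamma> b (Gcorr g \<gamma> Y) p $ k = corr2_residual g \<gamma> b Y p $ k"
      using res bc k AAY by (subst stage_residual_row[OF p(1) bc k])
        (auto simp: resolvedDC_def corr2_residual_def minus_div_Gcorr[OF Y(1)])
    ultimately show ?thesis using Y(2) p(2) by (simp add: same_row_def)
  qed
  have ex: "\<exists>p Y. fcdfDC g \<gamma> b Y p" if "b \<in> nonneg_data g" for b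
    using limited_stage_exists[OF g less_imp_le[OF \<gamma>(1)] \<gamma>(2) that] unfolding fcdfDC_def by blast
  show ?thesis
    unfolding realization_def step.simps second_order_space.simps
    using ex sos limited_stage_props[OF g less_imp_le[OF \<gamma>(1)]]
    by (auto simp: fcdfDC_def)
qed

section \<open>The linear maps\<close>

lemma pos_inverse_apply:
  assumes M: "M \<in> carrier_mat n n" and pos: "pos_inverse M"
    and mass: "\<And>p. p \<in> carrier_vec n \<Longrightarrow> mass (M *\<^sub>v p) = mass p"
    and b: "b \<in> carrier_vec n" "nonneg_vec b" and p: "apply_inverse M b p"
  shows "p \<in> carrier_vec n" "nonneg_vec p" "mass p = mass b" "M *\<^sub>v p = b"
proof -
  obtain B where B: "mat_inverse M = Some B" and Bpos: "\<And>i j. i < n \<Longrightarrow> j < n \<Longrightarrow> 0 < B $$ (i, j)"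
    using pos M by (auto simp: pos_inverse_def)
  have inv: "M * B = 1\<^sub>m n" "B \<in> carrier_mat n n" using mat_inverse(2)[OF M B] by auto
  have pB: "p = B *\<^sub>v b" using p B by (simp add: apply_inverse_def)
  show pc: "p \<in> carrier_vec n" unfolding pB using inv(2) b(1) by simp
  show Mp: "M *\<^sub>v p = b"
    unfolding pB using M inv b(1) by (simp flip: assoc_mult_mat_vec[of _ n n _ n])
  show "mass p = mass b" using mass[OF pc] by (simp add: Mp)
  show "nonneg_vec p"
    unfolding pB nonneg_vec_def using inv(2) b Bpos
    by (auto simp: scalar_prod_def nonneg_vec_def intro!: sum_nonneg mult_nonneg_nonneg intro: less_imp_le[OF Bpos])
qed

lemma realization_linear:
  assumes L: "L \<in> {Lin_Euler, Lin_Pade02}" and pos: "positive_map g L \<gamma>"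
  shows "realization g L \<gamma>"
proof -
  define M where "M = (if L = Lin_Euler then euler2_mat g \<gamma> else pade02_mat g \<gamma>)"
  have M: "M \<in> carrier_mat (npts g) (npts g)" by (simp add: M_def)
  have mass: "mass (M *\<^sub>v p) = mass p" if "p \<in> carrier_vec (npts g)" for p
    using that by (simp add: M_def mass_euler2 mass_pade02)
  have step: "step g L \<gamma> b p \<longleftrightarrow> apply_inverse M b p" for b p using L by (auto simp: M_def)
  have posM: "pos_inverse M" using L pos by (auto simp: M_def)
  have ex: "\<exists>p. apply_inverse M b p" for b
    using posM by (auto simp: pos_inverse_def apply_inverse_def)
  note props = pos_inverse_apply[OF M posM mass]
  have row: "(M *\<^sub>v p - b) $ k = 0"
    if "b \<in> nonneg_data g" "apply_inverse M b p" "k < npts g" for b p k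
    using props(4)[of b p] that by (auto simp: nonneg_data_def)
  have "second_order_space g L \<gamma>"
    using L row by (auto simp: M_def euler2_residual_def pade02_residual_def)
  moreover have "p \<in> carrier_vec (npts g) \<and> nonneg_vec p \<and> mass p = mass b"
    if "b \<in> nonneg_data g" "apply_inverse M b p" for b p
    using props(1-3)[of b p] that by (auto simp: nonneg_data_def)
  ultimately show ?thesis unfolding realization_def step using ex by blast
qed

section \<open>Order in time\<close>

lemma exp_quadratic_bigo:
  "(\<lambda>z::complex. 1 + z + z\<^sup>2 / 2 - exp z) \<in> O[at 0](\<lambda>z. z ^ 3)"
proof (rule bigoI)
  have "eventually (\<lambda>z::complex. norm z < 1) (at 0)"
    by (auto simp: eventually_at intro!: exI[of _ 1])
  then show "eventually (\<lambda>z::complex. norm (1 + z + z\<^sup>2 / 2 - exp z) \<le> exp 1 * norm (z ^ 3)) (at 0)"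
  proof eventually_elim
    case (elim z)
    have "norm (1 + z + z\<^sup>2 / 2 - exp z) = norm (exp z - (\<Sum>i\<le>2. z ^ i / fact i))"
      by (simp add: numeral_2_eq_2 norm_minus_commute)
    also have "\<dots> \<le> exp (norm z) * norm z ^ Suc 2 / fact 2" by (rule Taylor_exp_field)
    also have "\<dots> \<le> exp (norm z) * norm z ^ 3" by (simp add: numeral_3_eq_3 numeral_2_eq_2)
    also have "\<dots> \<le> exp 1 * norm z ^ 3" using elim by (intro mult_right_mono) auto
    finally show ?case by (simp add: norm_power)
  qed
qed

text \<open>Agreement with the quadratic Taylor polynomial up to a fourth order term divided by a
  denominator that does not vanish at 0.\<close>

lemma second_order_timeI:
  assumes q: "isCont q 0" "q 0 \<noteq> 0"
    and eq: "\<And>z. q z \<noteq> 0 \<Longrightarrow> stability S z - (1 + z + z\<^sup>2 / 2) = c * z ^ 4 / q z"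
  shows "second_order_time S"
proof -
  have lim: "((\<lambda>z. c * z / q z) \<longlongrightarrow> 0) (at 0)"
    using q by (auto intro!: tendsto_eq_intros simp: isCont_def)
  have "eventually (\<lambda>z. q z \<noteq> 0) (at 0)"
    using q by (intro tendsto_imp_eventually_ne) (auto simp: isCont_def)
  then have ev: "eventually (\<lambda>z. stability S z - (1 + z + z\<^sup>2 / 2) = c * z / q z * z ^ 3) (at 0)"
    proof eventually_elim
    case (elim z)
    have "z ^ 4 = z * z ^ 3" by (simp add: eval_nat_numeral)
    then show ?case using eq[OF elim] by simp
  qed
  have "(\<lambda>z. c * z / q z) \<in> O[at 0](\<lambda>_. 1)"
    by (intro landau_o.small_imp_big smalloI_tendsto) (use lim in simp_all)
  then have "(\<lambda>z. c * z / q z * z ^ 3) \<in> O[at 0](\<lambda>z. 1 * z ^ 3)"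
    by (rule landau_o.big.mult) simp
  then have "(\<lambda>z. stability S z - (1 + z + z\<^sup>2 / 2)) \<in> O[at 0](\<lambda>z. z ^ 3)"
    using landau_o.big.in_cong[OF ev] by simp
  from sum_in_bigo(1)[OF this exp_quadratic_bigo]
  show ?thesis by (simp add: second_order_time_def)
qed

lemma second_order_time_DC: "second_order_time FCDF_DC"
proof (rule second_order_timeI[where q = "\<lambda>z. (1 - z)\<^sup>2" and c = "- 1 / 2"])
  fix z :: complex assume "(1 - z)\<^sup>2 \<noteq> 0"
  then show "stability FCDF_DC z - (1 + z + z\<^sup>2 / 2) = - 1 / 2 * z ^ 4 / (1 - z)\<^sup>2"
    by (simp add: divide_simps) (simp add: algebra_simps power2_eq_square power4_eq_xxxx)
qed auto

lemma second_order_time_Pade: "second_order_time Lin_Pade02"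
proof (rule second_order_timeI[where q = "\<lambda>z. 1 - z + z\<^sup>2 / 2" and c = "- 1 / 4"])
  fix z :: complex assume nz: "1 - z + z\<^sup>2 / 2 \<noteq> 0"
  have "1 - (1 + z + z\<^sup>2 / 2) * (1 - z + z\<^sup>2 / 2) = - 1 / 4 * z ^ 4"
    by (simp add: field_simps power2_eq_square power4_eq_xxxx)
  then show "stability Lin_Pade02 z - (1 + z + z\<^sup>2 / 2) = - 1 / 4 * z ^ 4 / (1 - z + z\<^sup>2 / 2)"
    using nz by (simp only: stability.simps eq_divide_eq left_diff_distrib) simp
qed auto

section \<open>The switchover between the limited and the linear steps\<close>

theorem mainTheorem3:
  fixes g :: fp_grid and \<gamma>0 \<gamma>r :: ereal
  assumes grid: "valid_grid g"
    and irr: "irreducible_mat (A1 g)" "irreducible_mat (A2 g)"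
    and thresholds: "0 < \<gamma>0" "0 < \<gamma>r"
    and euler: "\<And>\<gamma>::real. \<gamma>0 \<le> ereal \<gamma> \<Longrightarrow> pos_inverse (euler2_mat g \<gamma>)"
    and pade: "\<And>\<gamma>::real. \<gamma>r \<le> ereal \<gamma> \<Longrightarrow> pos_inverse (pade02_mat g \<gamma>)"
  shows
    "(min \<gamma>0 \<gamma>r \<le> ereal (gamma_pic g) \<longrightarrow>
        (\<forall>\<gamma>>0. \<gamma> \<le> gamma_pic g \<or> min \<gamma>0 \<gamma>r \<le> ereal \<gamma>) \<and>
        (\<forall>\<gamma>>0. \<gamma> \<le> gamma_pic g \<longrightarrow> realization g FCDF_B \<gamma>) \<and>
        (\<forall>\<gamma>. min \<gamma>0 \<gamma>r \<le> ereal \<gamma> \<longrightarrow>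
           (\<exists>L\<in>{Lin_Euler, Lin_Pade02}. positive_map g L \<gamma>) \<and>
           (\<forall>L\<in>{Lin_Euler, Lin_Pade02}. positive_map g L \<gamma> \<longrightarrow> realization g L \<gamma>)) \<and>
        (\<forall>s L. min \<gamma>0 \<gamma>r \<le> ereal s \<and> s \<le> gamma_pic g \<and>
           (\<forall>\<gamma>\<ge>s. L \<gamma> \<in> {Lin_Euler, Lin_Pade02} \<and> positive_map g (L \<gamma>) \<gamma>) \<longrightarrow>
           (\<forall>\<gamma>>0. realization g (if \<gamma> \<le> s then FCDF_B else L \<gamma>) \<gamma> \<and>
                   realization g (if \<gamma> < s then FCDF_B else L \<gamma>) \<gamma>)))
     \<and>
     (\<gamma>r \<le> ereal (gamma_pic g) \<longrightarrow>
        (\<forall>\<gamma>>0. \<gamma> \<le> gamma_pic g \<or> \<gamma>r \<le> ereal \<gamma>) \<and>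
        (\<forall>\<gamma>>0. \<gamma> \<le> gamma_pic g \<longrightarrow> realization g FCDF_DC \<gamma>) \<and>
        (\<forall>\<gamma>. \<gamma>r \<le> ereal \<gamma> \<longrightarrow> positive_map g Lin_Pade02 \<gamma> \<and> realization g Lin_Pade02 \<gamma>) \<and>
        second_order_time FCDF_DC \<and> second_order_time Lin_Pade02)
     \<and>
     (\<gamma>r \<le> ereal (gamma_pic g) \<longrightarrow> min \<gamma>0 \<gamma>r \<le> ereal (gamma_pic g))"
proof -
  have overlap: "\<gamma> \<le> gamma_pic g \<or> t \<le> ereal \<gamma>" if "t \<le> ereal (gamma_pic g)" for t \<gamma>
    using that by (meson ereal_less_eq(3) linear order_trans)
  have pos: "\<exists>L\<in>{Lin_Euler, Lin_Pade02}. positive_map g L \<gamma>"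
    if "min \<gamma>0 \<gamma>r \<le> ereal \<gamma>" for \<gamma>
    using that euler[of \<gamma>] pade[of \<gamma>] by (auto simp: min_le_iff_disj)
  have B: "realization g FCDF_B \<gamma>" if "0 < \<gamma>" "\<gamma> \<le> gamma_pic g" for \<gamma>
    using realization_FCDF_B[OF grid that] .
  have switch: "realization g (if \<gamma> \<le> s then FCDF_B else L \<gamma>) \<gamma> \<and>
      realization g (if \<gamma> < s then FCDF_B else L \<gamma>) \<gamma>"
    if "s \<le> gamma_pic g" "\<forall>\<gamma>\<ge>s. L \<gamma> \<in> {Lin_Euler, Lin_Pade02} \<and> positive_map g (L \<gamma>) \<gamma>"
      "0 < \<gamma>" for s L \<gamma>
    using that B[of \<gamma>] realization_linear[of "L \<gamma>" g \<gamma>] by auto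
  have P: "positive_map g Lin_Pade02 \<gamma> \<and> realization g Lin_Pade02 \<gamma>" if "\<gamma>r \<le> ereal \<gamma>" for \<gamma>
    using pade[OF that] realization_linear[of Lin_Pade02 g \<gamma>] by simp
  have min: "\<gamma>r \<le> ereal \<gamma> \<Longrightarrow> min \<gamma>0 \<gamma>r \<le> ereal \<gamma>" for \<gamma>
    by (simp add: min_le_iff_disj)
  show ?thesis
    by (intro conjI impI allI)
      (use overlap in simp, use B in simp, use pos in simp, use realization_linear in blast,
       use switch in blast, use switch in blast, use overlap in simp,
       use realization_FCDF_DC[OF grid] in simp, use P in blast, use P in blast,
       rule second_order_time_DC, rule second_order_time_Pade, rule min)
qed

end
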